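(* Let $n$ be a positive integer, and consider all $2^{2n}\times(2n+2)$ two-level designs generated by $G=(v,I_n)$ as $v$ ranges over $Z_4^n$. For such $v$ and $i=0,1,2,3$, let $f_i$ be the number of entries of $v$ equal to $i$. Among all these designs: (a) If $n=3k-1$ with $k\ge1$, then a design $D$ defined by a vector $v$ with $f_1+f_3=2k-1$ and $f_2=k$ has minimum aberration, and its wordlength pattern is $A_{4k}(D)=3$. (b) If $n=3k$ with $k\ge1$, then a design $D$ defined by a vector $v$ with $f_1+f_3=2k$ and $f_2=k$ has minimum aberration, and its wordlength pattern is $A_{4k+1}(D)=2$ and $A_{4k+2}(D)=1$. (c) If $n=3k+1$ with $k\ge1$, then a design $D$ defined by a vector $v$ with $f_1+f_3=2k$ and $f_2=k+1$ has minimum aberration, and its wordlength pattern is $A_{4k+2}(D)=1$ and $A_{4k+3}(D)=2$.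
   Context: $Z_4=\{0,1,2,3\}$ is the ring of integers modulo 4. Design generated by $G=(v,I_n)$: let $C$ be the $2^{2n}\times(n+1)$ matrix whose rows are all linear combinations $uG$, $u\in Z_4^n$. Replace each entry of $C$ by a pair of $\pm1$ symbols via the Gray map $0\mapsto(1,1)$, $1\mapsto(1,-1)$, $2\mapsto(-1,-1)$, $3\mapsto(-1,1)$, so that column $j$ of $C$ becomes columns $2j-1,2j$. The result $D$ is a $2^{2n}\times(2n+2)$ matrix with entries $\pm1$ (a two-level design; rows are runs, columns are factors). For a two-level design $D$ with $N$ runs and $m$ factors and a nonempty set $s$ of $k$ columns, let $\rho_k(s;D)=\frac1N\left|\sum_{i=1}^N\prod_{c\in s}c_i\right|$, where $c_i$ is the $i$th entry of column $c$. Let $A_k(D)=\sum_{|s|=k}\rho_k(s;D)^2$ for $k=1,\dots,m$; the vector $(A_1(D),\dots,A_m(D))$ is the (generalized) wordlength pattern. When a wordlength pattern is specified by listing some components, all unlisted components are zero. A design $D$ has minimum aberration among a class of designs (with the same $N$ and $m$) if its wordlength pattern is lexicographically smallest (comparing $A_1$ first, then $A_2$, etc.) among the wordlength patterns of designs in the class. *)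

theory Defs
  imports "Jordan_Normal_Form.Matrix" "HOL-Library.Numeral_Type" "HOL-Library.Multiset"
begin

text \<open>The ring of integers modulo 4 is the numeral type \<open>4\<close>. Row and column indices start at 0.\<close>

definition generator_matrix :: "4 vec \<Rightarrow> 4 mat" where
  "generator_matrix v = mat_of_cols (dim_vec v) (v # cols (1\<^sub>m (dim_vec v)))"

text \<open>The linear combination \<open>u G\<close> of the rows of \<open>G\<close> is \<open>G\<^sup>T u\<close>. The rows of the code matrix
  are these combinations, one for each \<open>u\<close>, in an arbitrary order; the sum defining \<open>rho\<close> does
  not depend on that order.\<close>

definition code_matrix :: "4 vec \<Rightarrow> 4 mat \<Rightarrow> bool" where
  "code_matrix v C \<longleftrightarrow>
     C \<in> carrier_mat (2 ^ (2 * dim_vec v)) (dim_vec v + 1) \<and>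
     mset (rows C) =
       {#transpose_mat (generator_matrix v) *\<^sub>v u. u \<in># mset_set (carrier_vec (dim_vec v))#}"

definition gray :: "4 \<Rightarrow> int \<times> int" where
  "gray a = (if a = 0 then (1, 1) else if a = 1 then (1, -1)
             else if a = 2 then (-1, -1) else (-1, 1))"

definition gray_mat :: "4 mat \<Rightarrow> int mat" where
  "gray_mat C = mat (dim_row C) (2 * dim_col C)
     (\<lambda>(i, j). (if even j then fst else snd) (gray (C $$ (i, j div 2))))"

definition generated_by :: "4 vec \<Rightarrow> int mat \<Rightarrow> bool" where
  "generated_by v D \<longleftrightarrow> (\<exists>C. code_matrix v C \<and> D = gray_mat C)"

definition quaternary_designs :: "nat \<Rightarrow> int mat set" where
  "quaternary_designs n = {D. \<exists>v \<in> carrier_vec n. generated_by v D}"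

definition freq :: "4 \<Rightarrow> 4 vec \<Rightarrow> nat" where
  "freq a v = card {j. j < dim_vec v \<and> v $ j = a}"

definition rho :: "nat set \<Rightarrow> int mat \<Rightarrow> real" where
  "rho s D = real_of_int \<bar>\<Sum>i<dim_row D. \<Prod>c\<in>s. D $$ (i, c)\<bar> / real (dim_row D)"

definition A_wl :: "nat \<Rightarrow> int mat \<Rightarrow> real" where
  "A_wl k D = (\<Sum>s\<in>{s. s \<subseteq> {..<dim_col D} \<and> card s = k}. (rho s D)\<^sup>2)"

definition wordlength_pattern :: "int mat \<Rightarrow> real list" where
  "wordlength_pattern D = map (\<lambda>k. A_wl k D) [1..<dim_col D + 1]"

text \<open>The relation \<^const>\<open>lexordp_eq\<close> is the reflexive lexicographic order on lists. It is applied
  only to classes of designs that all have the same dimensions.\<close>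

definition minimum_aberration :: "int mat set \<Rightarrow> int mat \<Rightarrow> bool" where
  "minimum_aberration \<D> D \<longleftrightarrow>
     D \<in> \<D> \<and> (\<forall>D' \<in> \<D>. lexordp_eq (wordlength_pattern D) (wordlength_pattern D'))"

text \<open>Every \<open>v\<close> generates a design. In particular the multiset in \<^const>\<open>code_matrix\<close> is over a
  finite set with the required number of elements.\<close>

lemma carrier_vec_eq_image_lists:
  "carrier_vec n = vec_of_list ` {xs. set xs \<subseteq> (UNIV :: 'a set) \<and> length xs = n}"
proof (intro equalityI subsetI)
  fix v :: "'a vec"
  assume "v \<in> carrier_vec n"
  then have "v = vec_of_list (list_of_vec v)" "length (list_of_vec v) = n"
    by (simp_all add: vec_list)
  then show "v \<in> vec_of_list ` {xs. set xs \<subseteq> (UNIV :: 'a set) \<and> length xs = n}" by blast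
next
  fix v :: "'a vec"
  assume "v \<in> vec_of_list ` {xs. set xs \<subseteq> (UNIV :: 'a set) \<and> length xs = n}"
  then obtain xs where "v = vec_of_list xs" "length xs = n" by blast
  then show "v \<in> carrier_vec n" by (simp add: carrier_vecI)
qed

lemma finite_carrier_vec: "finite (carrier_vec n :: 'a :: finite vec set)"
  unfolding carrier_vec_eq_image_lists by (intro finite_imageI finite_lists_length_eq) simp

lemma card_carrier_vec: "card (carrier_vec n :: 'a :: finite vec set) = CARD('a) ^ n"
proof -
  have "inj_on vec_of_list {xs. set xs \<subseteq> (UNIV :: 'a set) \<and> length xs = n}"
    by (intro inj_on_inverseI[of _ list_of_vec]) (simp add: list_vec)
  then show ?thesis
    unfolding carrier_vec_eq_image_lists
    by (subst card_image) (simp_all add: card_lists_length_eq[of UNIV, simplified])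
qed

lemma generated_by_exists: "\<exists>D. generated_by v D"
proof -
  let ?n = "dim_vec v"
  let ?M = "{#transpose_mat (generator_matrix v) *\<^sub>v u. u \<in># mset_set (carrier_vec ?n)#}"
  obtain xs where xs: "mset xs = ?M" using ex_mset by blast
  have "size ?M = 4 ^ ?n"
    by (simp add: card_carrier_vec)
  then have len: "length xs = 2 ^ (2 * ?n)"
    using xs by (simp add: power_mult flip: size_mset)
  have "set xs \<subseteq> carrier_vec (?n + 1)"
  proof -
    have "set xs = set_mset ?M" using xs by (metis set_mset_mset)
    then show ?thesis
      by (auto simp: generator_matrix_def intro!: carrier_vecI)
  qed
  then have "rows (mat_of_rows (?n + 1) xs) = xs" by (rule rows_mat_of_rows)
  then have "code_matrix v (mat_of_rows (?n + 1) xs)"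
    unfolding code_matrix_def using xs len by (simp add: carrier_matI)
  then show ?thesis unfolding generated_by_def by blast
qed

end

theory Submission
  imports Defs "HOL-Library.FuncSet" "HOL-Computational_Algebra.Polynomial" Complex_Main
begin

text \<open>Write \<open>f = f\<^sub>1 + f\<^sub>3\<close> and \<open>t = f\<^sub>2\<close>. Summing \<open>\<rho>(s)\<^sup>2 x\<^bsup>|s|\<^esup>\<close> over all sets \<open>s\<close> of columns
  gives an average, over pairs of runs, of a product over columns. The two columns that the Gray map
  makes of one quaternary column contribute a function of the difference \<open>a\<close> of the quaternary
  entries only, with Fourier expansion \<open>\<Sum>\<^sub>w x\<^bsup>lee w\<^esup> \<i>\<^bsup>w a\<^esup>\<close>. Orthogonality of characters then turns
  the average into the Lee weight enumerator of the dual code, which consists of the multiples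
  \<open>w (1, v)\<close> up to signs. So the wordlength pattern has a word of length \<open>p = 2 f + 2\<close> (from \<open>w = 2\<close>)
  and two units at length \<open>q = f + 2 t + 1\<close> (from \<open>w = 1, 3\<close>), and nothing else. Since \<open>f + t \<le> n\<close>,
  we have \<open>p + 2 q \<le> 4 n + 4\<close> with \<open>p\<close> even, and optimality is a comparison of such pairs.\<close>

section \<open>Characters of the integers modulo 4 and the Lee weight\<close>

definition z4_char :: "4 \<Rightarrow> complex" where
  "z4_char a = (if a = 0 then 1 else if a = 1 then \<i> else if a = 2 then -1 else -\<i>)"

definition lee_weight :: "4 \<Rightarrow> nat" where
  "lee_weight a = (if a = 0 then 0 else if a = 2 then 2 else 1)"

definition lee_enum :: "complex \<Rightarrow> 4 \<Rightarrow> complex" where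
  "lee_enum x a = (\<Sum>w\<in>UNIV. x ^ lee_weight w * z4_char (w * a))"

lemma z4_cases: "a = 0 \<or> a = 1 \<or> a = 2 \<or> a = 3" for a :: 4
proof -
  have "card {0, 1, 2, 3 :: 4} = CARD(4)" by simp
  then have "{0, 1, 2, 3 :: 4} = UNIV" by (intro card_eq_UNIV_imp_eq_UNIV) simp_all
  then show ?thesis by blast
qed

lemma sum_UNIV_z4: "(\<Sum>a\<in>UNIV. g a) = g 0 + g 1 + g 2 + g 3"
  for g :: "4 \<Rightarrow> 'a::comm_monoid_add"
proof -
  have "(UNIV :: 4 set) = {0, 1, 2, 3}" using z4_cases by blast
  then have "sum g UNIV = sum g {0, 1, 2, 3}" by (rule arg_cong)
  then show ?thesis by (simp add: add.assoc)
qed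

lemma z4_char_add: "z4_char (a + b) = z4_char a * z4_char b"
  using z4_cases[of a] z4_cases[of b] by (auto simp: z4_char_def)

lemma z4_char_sum: "z4_char (\<Sum>j\<in>A. f j) = (\<Prod>j\<in>A. z4_char (f j))"
  by (induction A rule: infinite_finite_induct) (simp_all add: z4_char_add, simp_all add: z4_char_def)

text \<open>Fourier inversion returns the weight of \<open>- w\<close>, which is that of
  \<open>w\<close> because negation preserves the Lee weight.\<close>

lemma lee_enum_inversion: "(\<Sum>a\<in>UNIV. z4_char (w * a) * lee_enum x a) = 4 * x ^ lee_weight w"
  using z4_cases[of w]
  by (auto simp: sum_UNIV_z4 lee_enum_def z4_char_def lee_weight_def algebra_simps power2_eq_square)

lemma lee_enum_values:
  "lee_enum x 0 = (1 + x)\<^sup>2" "lee_enum x 1 = 1 - x\<^sup>2"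
  "lee_enum x 2 = (1 - x)\<^sup>2" "lee_enum x 3 = 1 - x\<^sup>2"
  by (simp_all add: sum_UNIV_z4 lee_enum_def z4_char_def lee_weight_def algebra_simps power2_eq_square)

text \<open>The Gray images of \<open>a\<close> and \<open>b\<close> agree in two, one or no
  positions according as \<open>a - b\<close> is 0, odd or 2; this gives the closed forms in
  \<open>lee_enum_values\<close>.\<close>

lemma gray_pair_product:
  "(1 + x * of_int (fst (gray a) * fst (gray b))) * (1 + x * of_int (snd (gray a) * snd (gray b)))
     = lee_enum x (a - b)"
proof -
  have "(1 + x * of_int (fst (gray (d + b)) * fst (gray b)))
      * (1 + x * of_int (snd (gray (d + b)) * snd (gray b))) = lee_enum x d" for d
    using z4_cases[of d] z4_cases[of b]
    by (elim disjE) (simp_all add: lee_enum_values gray_def algebra_simps power2_eq_square)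
  from this[of "a - b"] show ?thesis by simp
qed

section \<open>Character sums over the code\<close>

lemma sum_carrier_vec_prod:
  fixes h :: "nat \<Rightarrow> 'a::finite \<Rightarrow> 'b::comm_semiring_1"
  shows "(\<Sum>u\<in>carrier_vec n. \<Prod>j<n. h j (u $ j)) = (\<Prod>j<n. \<Sum>a\<in>UNIV. h j a)"
proof -
  have "(\<Prod>j<n. \<Sum>a\<in>UNIV. h j a) = (\<Sum>g\<in>{..<n} \<rightarrow>\<^sub>E UNIV. \<Prod>j<n. h j (g j))"
    by (intro prod_sum_PiE) simp_all
  also have "\<dots> = (\<Sum>u\<in>carrier_vec n. \<Prod>j<n. h j (u $ j))"
    by (rule sum.reindex_bij_witness[of _ "\<lambda>u. restrict (vec_index u) {..<n}" "vec n"])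
       (auto simp: fun_eq_iff restrict_def PiE_def extensional_def)
  finally show ?thesis by simp
qed

lemma sum_translate: "(\<Sum>a\<in>UNIV. f (a - b)) = (\<Sum>a\<in>UNIV. f a)"
  for b :: "'a::{finite, ab_group_add}"
  by (rule sum.reindex_bij_witness[of _ "\<lambda>a. a + b" "\<lambda>a. a - b"]) auto

lemma code_matrix_row_index:
  assumes "u \<in> carrier_vec (dim_vec v)"
  shows "(transpose_mat (generator_matrix v) *\<^sub>v u) $ 0 = v \<bullet> u"
    and "j < dim_vec v \<Longrightarrow> (transpose_mat (generator_matrix v) *\<^sub>v u) $ Suc j = u $ j"
  using assms by (simp_all add: generator_matrix_def)

text \<open>Only coordinate 0 of a row is not free, so only it is expanded into characters. For
  fixed \<open>w\<close> the sum over \<open>u\<close> then splits by coordinates, and translation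
  by \<open>u'\<close> leaves each factor unchanged, so every \<open>u'\<close> contributes
  equally.\<close>

lemma sum_row_differences:
  fixes v :: "4 vec"
  defines "r \<equiv> \<lambda>u. transpose_mat (generator_matrix v) *\<^sub>v u"
  assumes v: "v \<in> carrier_vec n"
  shows "(\<Sum>u\<in>carrier_vec n. \<Sum>u'\<in>carrier_vec n. \<Prod>j<n + 1. lee_enum x (r u $ j - r u' $ j))
    = (4 ^ n)\<^sup>2 * (\<Sum>w\<in>UNIV. x ^ (lee_weight w + (\<Sum>j<n. lee_weight (w * v $ j))))"
proof -
  \<comment> \<open>\<open>h w j\<close> joins the factor of coordinate \<open>Suc j\<close> with
    what the expanded coordinate 0 contributes for entry \<open>j\<close>.\<close>
  define h where "h w j a = z4_char (w * v $ j * a) * lee_enum x a" for w j a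
  have row: "(\<Prod>j<n + 1. lee_enum x (r u $ j - r u' $ j))
      = (\<Sum>w\<in>UNIV. x ^ lee_weight w * (\<Prod>j<n. h w j (u $ j - u' $ j)))"
    if u: "u \<in> carrier_vec n" "u' \<in> carrier_vec n" for u u'
  proof -
    have "w * (v \<bullet> u - v \<bullet> u') = (\<Sum>j<n. w * v $ j * (u $ j - u' $ j))" for w
      using v u by (simp add: scalar_prod_def sum_distrib_left sum_subtractf
          lessThan_atLeast0 algebra_simps)
    then have "lee_enum x (v \<bullet> u - v \<bullet> u')
        = (\<Sum>w\<in>UNIV. x ^ lee_weight w * (\<Prod>j<n. z4_char (w * v $ j * (u $ j - u' $ j))))"
      by (simp add: lee_enum_def z4_char_sum)
    then show ?thesis
      using v u unfolding r_def
      by (simp add: prod.lessThan_Suc_shift code_matrix_row_index sum_distrib_right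
          h_def prod.distrib mult.assoc del: index_mult_mat_vec prod.lessThan_Suc)
  qed
  have "(\<Sum>u\<in>carrier_vec n. \<Prod>j<n. h w j (u $ j - u' $ j))
      = 4 ^ n * x ^ (\<Sum>j<n. lee_weight (w * v $ j))" for w u'
  proof -
    have "(\<Sum>u\<in>carrier_vec n. \<Prod>j<n. h w j (u $ j - u' $ j))
        = (\<Prod>j<n. \<Sum>a\<in>UNIV. h w j (a - u' $ j))"
      by (rule sum_carrier_vec_prod)
    also have "\<dots> = (\<Prod>j<n. 4 * x ^ lee_weight (w * v $ j))"
      by (simp only: sum_translate) (simp add: h_def lee_enum_inversion)
    finally show ?thesis by (simp add: prod.distrib power_sum)
  qed
  then have inner: "(\<Sum>u\<in>carrier_vec n. \<Sum>w\<in>UNIV. x ^ lee_weight w * (\<Prod>j<n. h w j (u $ j - u' $ j)))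
      = 4 ^ n * (\<Sum>w\<in>UNIV. x ^ (lee_weight w + (\<Sum>j<n. lee_weight (w * v $ j))))" for u'
    by (subst sum.swap) (simp add: power_add sum_distrib_left[of _ _ UNIV] mult.left_commute flip: sum_distrib_left[of _ _ "carrier_vec n"])
  have "(\<Sum>u\<in>carrier_vec n. \<Sum>u'\<in>carrier_vec n. \<Prod>j<n + 1. lee_enum x (r u $ j - r u' $ j))
      = (\<Sum>u'\<in>carrier_vec n. \<Sum>u\<in>carrier_vec n.
          \<Sum>w\<in>UNIV. x ^ lee_weight w * (\<Prod>j<n. h w j (u $ j - u' $ j)))"
    by (subst sum.swap) (intro sum.cong refl row)
  then show ?thesis
    by (simp only: inner) (simp add: card_carrier_vec power2_eq_square)
qed

section \<open>The wordlength enumerator as a sum over pairs of runs\<close>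

lemma rho_times_runs:
  "rho s D * dim_row D = \<bar>\<Sum>i<dim_row D. \<Prod>c\<in>s. D $$ (i, c)\<bar>"
  by (simp add: rho_def)

text \<open>Squaring a sum over runs gives pairs of runs, and the sum over all sets of columns is an
  expanded product of binomials. The index 0 is included to cover the empty set.\<close>

lemma sum_A_wl_power:
  fixes x :: complex
  shows "(of_nat (dim_row D))\<^sup>2 * (\<Sum>k\<le>dim_col D. of_real (A_wl k D) * x ^ k)
    = (\<Sum>i<dim_row D. \<Sum>i'<dim_row D. \<Prod>c<dim_col D. 1 + x * of_int (D $$ (i, c) * D $$ (i', c)))"
proof -
  let ?N = "dim_row D" and ?M = "dim_col D"
  define S where "S s = (\<Sum>i<?N. \<Prod>c\<in>s. D $$ (i, c))" for s
  have rho: "(of_nat ?N)\<^sup>2 * of_real ((rho s D)\<^sup>2) = (of_int (S s ^ 2) :: complex)" for s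
  proof -
    have "(real ?N)\<^sup>2 * (rho s D)\<^sup>2 = of_int (S s ^ 2)"
      using rho_times_runs[of s D] by (simp add: S_def mult.commute flip: power_mult_distrib)
    then have "of_real ((real ?N)\<^sup>2 * (rho s D)\<^sup>2) = (of_real (of_int (S s ^ 2)) :: complex)"
      by (simp only:)
    then show ?thesis by simp
  qed
  have "(of_nat ?N)\<^sup>2 * (\<Sum>k\<le>?M. of_real (A_wl k D) * x ^ k)
      = (\<Sum>k\<le>?M. \<Sum>s\<in>{s. s \<in> Pow {..<?M} \<and> card s = k}.
          (of_nat ?N)\<^sup>2 * of_real ((rho s D)\<^sup>2) * x ^ card s)"
    by (simp add: A_wl_def sum_distrib_left sum_distrib_right mult.assoc)
  also have "\<dots> = (\<Sum>k\<le>?M. \<Sum>s\<in>{s. s \<in> Pow {..<?M} \<and> card s = k}. of_int (S s ^ 2) * x ^ card s)"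
    by (simp only: rho)
  also have "\<dots> = (\<Sum>s\<in>Pow {..<?M}. of_int (S s ^ 2) * x ^ card s)"
    by (rule sum.group) (auto dest: subset_eq_atLeast0_lessThan_card
        simp: lessThan_atLeast0)
  also have "\<dots> = (\<Sum>s\<in>Pow {..<?M}. \<Sum>i<?N. \<Sum>i'<?N.
      \<Prod>c\<in>s. x * of_int (D $$ (i, c) * D $$ (i', c)))"
    by (simp add: S_def power2_eq_square sum_product sum_distrib_left prod.distrib mult_ac)
  also have "\<dots> = (\<Sum>i<?N. \<Sum>i'<?N. \<Sum>s\<in>Pow {..<?M}.
      \<Prod>c\<in>s. x * of_int (D $$ (i, c) * D $$ (i', c)))"
    by (subst sum.swap, intro sum.cong refl sum.swap)
  also have "\<dots> = (\<Sum>i<?N. \<Sum>i'<?N. \<Prod>c<?M. x * of_int (D $$ (i, c) * D $$ (i', c)) + 1)"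
    by (subst prod_add) simp_all
  finally show ?thesis by (simp only: add.commute)
qed

lemma prod_gray_rows:
  assumes "i < dim_row C" "i' < dim_row C"
  shows "(\<Prod>c<2 * dim_col C. 1 + x * of_int (gray_mat C $$ (i, c) * gray_mat C $$ (i', c)))
    = (\<Prod>j<dim_col C. lee_enum x (C $$ (i, j) - C $$ (i', j)))"
proof -
  \<comment> \<open>Regrouping in blocks of two collects the Gray image of each quaternary
    column.\<close>
  have block: "{j * 2..<j * 2 + 2} = {2 * j, Suc (2 * j)}" for j :: nat by auto
  have "(\<Prod>c<2 * dim_col C. 1 + x * of_int (gray_mat C $$ (i, c) * gray_mat C $$ (i', c)))
      = (\<Prod>j<dim_col C. \<Prod>c\<in>{j * 2..<j * 2 + 2}.
          1 + x * of_int (gray_mat C $$ (i, c) * gray_mat C $$ (i', c)))"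
    by (simp only: prod.nat_group mult.commute)
  also have "\<dots> = (\<Prod>j<dim_col C. lee_enum x (C $$ (i, j) - C $$ (i', j)))"
    using assms by (intro prod.cong refl)
      (simp add: block gray_mat_def flip: gray_pair_product)
  finally show ?thesis .
qed

lemma sum_rows:
  "(\<Sum>i<dim_row C. f (row C i)) = (\<Sum>r\<in>#mset (rows C). f r)"
  by (simp add: rows_def sum_mset_sum_list interv_sum_list_conv_sum_set_nat lessThan_atLeast0
      comp_def flip: mset_map)

text \<open>A sum over runs depends only on the multiset of rows, which is all that
  \<open>code_matrix\<close> fixes about their order.\<close>

lemma sum_code_matrix_rows:
  assumes "code_matrix v C"
  shows "(\<Sum>i<dim_row C. f (row C i))
    = (\<Sum>u\<in>carrier_vec (dim_vec v). f (transpose_mat (generator_matrix v) *\<^sub>v u))"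
proof -
  have "mset (rows C) = image_mset (\<lambda>u. transpose_mat (generator_matrix v) *\<^sub>v u)
      (mset_set (carrier_vec (dim_vec v)))"
    using assms by (simp add: code_matrix_def)
  then show ?thesis
    by (simp only: sum_rows) (simp add: sum_unfold_sum_mset image_mset.compositionality comp_def)
qed

lemma generated_by_dim:
  assumes "generated_by v D"
  shows "dim_row D = 4 ^ dim_vec v" "dim_col D = 2 * dim_vec v + 2"
  using assms by (auto simp: generated_by_def code_matrix_def gray_mat_def power_mult)

lemma wordlength_enumerator:
  fixes x :: complex
  assumes "generated_by v D" and v: "v \<in> carrier_vec n"
  shows "(\<Sum>k\<le>2 * n + 2. of_real (A_wl k D) * x ^ k)
    = (\<Sum>w\<in>UNIV. x ^ (lee_weight w + (\<Sum>j<n. lee_weight (w * v $ j))))"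
proof -
  obtain C where C: "code_matrix v C" and D: "D = gray_mat C"
    using assms(1) by (auto simp: generated_by_def)
  let ?r = "\<lambda>u. transpose_mat (generator_matrix v) *\<^sub>v u"
  have dim: "dim_row D = 4 ^ n" "dim_col D = 2 * n + 2" "dim_row C = 4 ^ n" "dim_col C = n + 1"
    "dim_vec v = n"
    using generated_by_dim[OF assms(1)] v C by (auto simp: code_matrix_def power_mult)
  have "(4 ^ n)\<^sup>2 * (\<Sum>k\<le>2 * n + 2. of_real (A_wl k D) * x ^ k)
      = (\<Sum>i<dim_row C. \<Sum>i'<dim_row C. \<Prod>j<n + 1. lee_enum x (row C i $ j - row C i' $ j))"
    using sum_A_wl_power[of D x] prod_gray_rows[of _ C _ x] by (simp add: dim flip: D)
  also have "\<dots> = (\<Sum>u\<in>carrier_vec n. \<Sum>u'\<in>carrier_vec n.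
      \<Prod>j<n + 1. lee_enum x (?r u $ j - ?r u' $ j))"
    \<comment> \<open>The inner sum is reindexed for each fixed row \<open>r'\<close>, then the
      outer one.\<close>
    using sum_code_matrix_rows[OF C, of "\<lambda>r. \<Prod>j<n + 1. lee_enum x (r' $ j - r $ j)" for r']
      sum_code_matrix_rows[OF C, of "\<lambda>r. \<Sum>u'\<in>carrier_vec n.
        \<Prod>j<n + 1. lee_enum x (r $ j - ?r u' $ j)"]
    by (simp only: dim)
  also have "\<dots> = (4 ^ n)\<^sup>2 * (\<Sum>w\<in>UNIV. x ^ (lee_weight w + (\<Sum>j<n. lee_weight (w * v $ j))))"
    by (rule sum_row_differences[OF v])
  finally show ?thesis
    by (rule mult_left_cancel[THEN iffD1, rotated]) simp
qed

section \<open>The wordlength pattern in terms of entry frequencies\<close>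

lemma sum_freq:
  fixes g :: "4 \<Rightarrow> nat"
  assumes "v \<in> carrier_vec n"
  shows "(\<Sum>j<n. g (v $ j)) = (\<Sum>a\<in>UNIV. freq a v * g a)"
proof -
  have "(\<Sum>j<n. g (v $ j)) = (\<Sum>a\<in>UNIV. \<Sum>j\<in>{j\<in>{..<n}. v $ j = a}. g (v $ j))"
    by (rule sum.group[symmetric]) simp_all
  also have "\<dots> = (\<Sum>a\<in>UNIV. freq a v * g a)"
    using assms by (simp add: freq_def)
  finally show ?thesis .
qed

lemma freq_le:
  assumes "v \<in> carrier_vec n"
  shows "freq 1 v + freq 3 v + freq 2 v \<le> n"
  using sum_freq[OF assms, of "\<lambda>_. 1"] by (simp add: sum_UNIV_z4)

text \<open>The contributions are added, not nested, so that \<open>p = q\<close> yields the value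
  3.\<close>

definition two_length_pattern :: "nat \<Rightarrow> nat \<Rightarrow> nat \<Rightarrow> real" where
  "two_length_pattern p q k = (if k = p then 1 else 0) + (if k = q then 2 else 0)"

lemma A_wl_generated:
  assumes "generated_by v D" and v: "v \<in> carrier_vec n" and k: "k \<in> {1..2 * n + 2}"
  defines "f \<equiv> freq 1 v + freq 3 v"
  shows "A_wl k D = two_length_pattern (2 * f + 2) (f + 2 * freq 2 v + 1) k"
proof -
  define P where "P = (\<Sum>k\<le>2 * n + 2. monom (of_real (A_wl k D) :: complex) k)"
  define Q where "Q = monom (1 :: complex) 0 + monom 1 (2 * f + 2) + monom 2 (f + 2 * freq 2 v + 1)"
  \<comment> \<open>Multiplication by 1 or 3 keeps odd entries odd and fixes the entry 2;
    multiplication by 2 sends odd entries to 2 and even ones to 0.\<close>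
  have exponents: "(\<Sum>j<n. lee_weight (0 * v $ j)) = 0"
    "(\<Sum>j<n. lee_weight (1 * v $ j)) = f + 2 * freq 2 v"
    "(\<Sum>j<n. lee_weight (2 * v $ j)) = 2 * f"
    "(\<Sum>j<n. lee_weight (3 * v $ j)) = f + 2 * freq 2 v"
    unfolding sum_freq[OF v, of "\<lambda>a. lee_weight (w * a)" for w]
    by (simp_all add: sum_UNIV_z4 lee_weight_def f_def)
  have "poly P x = poly Q x" for x
  proof -
    have "poly P x = (\<Sum>w\<in>UNIV. x ^ (lee_weight w + (\<Sum>j<n. lee_weight (w * v $ j))))"
      using wordlength_enumerator[OF assms(1) v, of x] by (simp only: P_def poly_sum poly_monom)
    also have "\<dots> = 1 + x ^ (1 + (f + 2 * freq 2 v)) + x ^ (2 + 2 * f) + x ^ (1 + (f + 2 * freq 2 v))"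
      by (simp only: sum_UNIV_z4 exponents) (simp add: lee_weight_def)
    also have "\<dots> = poly Q x"
      by (simp add: Q_def poly_monom)
    finally show ?thesis .
  qed
  then have "poly P = poly Q" by (rule ext)
  then have "P = Q" by (simp only: poly_eq_poly_eq_iff)
  moreover have "coeff P k = of_real (A_wl k D)"
    unfolding P_def using k by (intro coeff_sum_monom) simp
  ultimately have "complex_of_real (A_wl k D) = coeff Q k" by simp
  \<comment> \<open>As \<open>k\<close> is at least 1, the constant term, which comes from
    \<open>w = 0\<close>, drops out.\<close>
  also have "\<dots> = of_real (two_length_pattern (2 * f + 2) (f + 2 * freq 2 v + 1) k)"
    using k by (auto simp: Q_def two_length_pattern_def)
  finally show ?thesis by (simp only: of_real_eq_iff)
qed

section \<open>Lexicographic comparison and a criterion for optimality\<close>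

lemma lexordp_eq_map_upt:
  fixes f g :: "nat \<Rightarrow> 'a::linorder"
  assumes "\<And>j. a \<le> j \<Longrightarrow> j < m \<Longrightarrow> f j = g j" and "a \<le> m" "m < b" "f m < g m"
  shows "lexordp_eq (map f [a..<b]) (map g [a..<b])"
proof -
  have "[a..<b] = [a..<m] @ m # [Suc m..<b]"
    using upt_add_eq_append[of a m "b - m"] assms(2,3) by (simp add: upt_conv_Cons)
  moreover have "map f [a..<m] = map g [a..<m]" using assms by simp
  ultimately have "ord_class.lexordp (map f [a..<b]) (map g [a..<b])"
    by (simp only: map_append list.map lexordp_append_left_rightI[OF assms(4)])
  then show ?thesis by (rule lexordp_into_lexordp_eq)
qed

text \<open>Beyond equality, the competitor loses in two ways: it has a shorter word, or both
  patterns start at \<open>p\<close>, where the first has the value 1 and the competitor at least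
  2.\<close>

lemma lexordp_eq_two_length_pattern:
  assumes "p' = p \<and> q' = q \<or> min p' q' < min p q \<or> p < q \<and> q' = p \<and> p \<le> p'"
    and "1 \<le> p'" "1 \<le> q'" "p < b" "p' < b"
  shows "lexordp_eq (map (two_length_pattern p q) [1..<b]) (map (two_length_pattern p' q') [1..<b])"
  using assms(1)
proof (elim disjE)
  assume "p' = p \<and> q' = q"
  then show ?thesis by (simp add: lexordp_eq_refl)
next
  assume "min p' q' < min p q"
  moreover define m where "m = min p' q'"
  ultimately have "m < p" "m < q" "m \<le> p'" "m \<le> q'" "m = p' \<or> m = q'"
    by auto
  with assms(2-5) show ?thesis
    by (intro lexordp_eq_map_upt[of _ m]) (auto simp: two_length_pattern_def)
next
  assume "p < q \<and> q' = p \<and> p \<le> p'"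
  with assms show ?thesis
    by (intro lexordp_eq_map_upt[of _ p]) (auto simp: two_length_pattern_def)
qed

lemma wordlength_pattern_generated:
  assumes "generated_by v D" and "v \<in> carrier_vec n"
  shows "wordlength_pattern D = map (two_length_pattern (2 * (freq 1 v + freq 3 v) + 2)
      (freq 1 v + freq 3 v + 2 * freq 2 v + 1)) [1..<2 * n + 3]"
proof -
  have "dim_col D + 1 = 2 * n + 3"
    using generated_by_dim(2)[OF assms(1)] assms(2) by simp
  moreover have "A_wl k D = two_length_pattern (2 * (freq 1 v + freq 3 v) + 2)
      (freq 1 v + freq 3 v + 2 * freq 2 v + 1) k" if "k \<in> set [1..<2 * n + 3]" for k
    using that by (intro A_wl_generated[OF assms]) auto
  ultimately show ?thesis
    unfolding wordlength_pattern_def by (intro map_cong) (simp_all only:)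
qed

text \<open>A competitor with a word shorter than \<open>m\<close> loses at once, so
  \<open>opt\<close> concerns only the others. The condition \<open>f + 1 < 2 * t\<close> says that
  the single unit of \<open>D\<close> comes before its double one.\<close>

lemma minimum_aberrationI:
  assumes D: "generated_by v D" "v \<in> carrier_vec n"
    and f: "freq 1 v + freq 3 v = f" "freq 2 v = t"
    and m: "m = min (2 * f + 2) (f + 2 * t + 1)"
    and opt: "\<And>f' t'. f' + t' \<le> n \<Longrightarrow> m \<le> 2 * f' + 2 \<Longrightarrow> m \<le> f' + 2 * t' + 1
      \<Longrightarrow> f' = f \<and> t' = t \<or> f + 1 < 2 * t \<and> f' + 2 * t' + 1 = 2 * f + 2 \<and> f \<le> f'"
  shows "minimum_aberration (quaternary_designs n) D"
  unfolding minimum_aberration_def quaternary_designs_def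
proof safe
  show "\<exists>v\<in>carrier_vec n. generated_by v D" using D by blast
next
  fix v' D' assume D': "v' \<in> carrier_vec n" "generated_by v' D'"
  define f' t' where "f' = freq 1 v' + freq 3 v'" and "t' = freq 2 v'"
  have le: "f' + t' \<le> n" "f + t \<le> n"
    using freq_le[OF D'(1)] freq_le[OF D(2)] by (simp_all add: f'_def t'_def flip: f)
  have "f' = f \<and> t' = t \<or> min (2 * f' + 2) (f' + 2 * t' + 1) < m
      \<or> f + 1 < 2 * t \<and> f' + 2 * t' + 1 = 2 * f + 2 \<and> f \<le> f'"
    using opt[OF le(1)] by (meson min.boundedE not_less)
  then have "lexordp_eq (map (two_length_pattern (2 * f + 2) (f + 2 * t + 1)) [1..<2 * n + 3])
      (map (two_length_pattern (2 * f' + 2) (f' + 2 * t' + 1)) [1..<2 * n + 3])"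
    using le unfolding m by (intro lexordp_eq_two_length_pattern) auto
  then show "lexordp_eq (wordlength_pattern D) (wordlength_pattern D')"
    using wordlength_pattern_generated[OF D] wordlength_pattern_generated[OF D'(2,1)]
    by (simp only: f f'_def t'_def)
qed

section \<open>The three residue classes of \<open>n\<close> modulo 3\<close>

theorem theorem6:
  fixes n k :: nat and v :: "4 vec" and D :: "int mat"
  assumes "n \<ge> 1" and "k \<ge> 1"
    and "v \<in> carrier_vec n" and "generated_by v D"
  shows
    "(n = 3 * k - 1 \<and> freq 1 v + freq 3 v = 2 * k - 1 \<and> freq 2 v = k \<longrightarrow>
        minimum_aberration (quaternary_designs n) D \<and>
        (\<forall>j \<in> {1..2 * n + 2}. A_wl j D = (if j = 4 * k then 3 else 0))) \<and>
     (n = 3 * k \<and> freq 1 v + freq 3 v = 2 * k \<and> freq 2 v = k \<longrightarrow>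
        minimum_aberration (quaternary_designs n) D \<and>
        (\<forall>j \<in> {1..2 * n + 2}. A_wl j D =
           (if j = 4 * k + 1 then 2 else if j = 4 * k + 2 then 1 else 0))) \<and>
     (n = 3 * k + 1 \<and> freq 1 v + freq 3 v = 2 * k \<and> freq 2 v = k + 1 \<longrightarrow>
        minimum_aberration (quaternary_designs n) D \<and>
        (\<forall>j \<in> {1..2 * n + 2}. A_wl j D =
           (if j = 4 * k + 2 then 1 else if j = 4 * k + 3 then 2 else 0)))"
proof (intro conjI impI ballI; elim conjE)
  assume n: "n = 3 * k - 1" and f: "freq 1 v + freq 3 v = 2 * k - 1" "freq 2 v = k"
  show "minimum_aberration (quaternary_designs n) D"
  proof (rule minimum_aberrationI[OF assms(4,3) f])
    show "4 * k = min (2 * (2 * k - 1) + 2) (2 * k - 1 + 2 * k + 1)" using assms(2) by simp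
    fix f' t' assume "f' + t' \<le> n" "4 * k \<le> 2 * f' + 2" "4 * k \<le> f' + 2 * t' + 1"
    \<comment> \<open>Twice the first bound minus the third gives \<open>f' \<le> 2 * k - 1\<close>;
      the second gives the converse.\<close>
    then have "f' = 2 * k - 1 \<and> t' = k" using n by linarith
    then show "f' = 2 * k - 1 \<and> t' = k
        \<or> 2 * k - 1 + 1 < 2 * k \<and> f' + 2 * t' + 1 = 2 * (2 * k - 1) + 2 \<and> 2 * k - 1 \<le> f'" ..
  qed
  fix j assume "j \<in> {1..2 * n + 2}"
  \<comment> \<open>Both lengths coincide, so the values 1 and 2 add up to 3;
    \<open>k \<ge> 1\<close> makes the subtraction exact.\<close>
  moreover have "2 * (2 * k - 1) + 2 = 4 * k" "2 * k - 1 + 2 * k + 1 = 4 * k"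
    using assms(2) by simp_all
  ultimately show "A_wl j D = (if j = 4 * k then 3 else 0)"
    by (simp only: A_wl_generated[OF assms(4,3)] f) (simp add: two_length_pattern_def)
next
  assume n: "n = 3 * k" and f: "freq 1 v + freq 3 v = 2 * k" "freq 2 v = k"
  show "minimum_aberration (quaternary_designs n) D"
  proof (rule minimum_aberrationI[OF assms(4,3) f])
    show "4 * k + 1 = min (2 * (2 * k) + 2) (2 * k + 2 * k + 1)" by simp
    fix f' t' assume "f' + t' \<le> n" "4 * k + 1 \<le> 2 * f' + 2" "4 * k + 1 \<le> f' + 2 * t' + 1"
    \<comment> \<open>The length \<open>2 * f' + 2\<close> is even, so its lower bound improves to
      \<open>4 * k + 2\<close>.\<close>
    then have "f' = 2 * k \<and> t' = k" using n by linarith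
    then show "f' = 2 * k \<and> t' = k
        \<or> 2 * k + 1 < 2 * k \<and> f' + 2 * t' + 1 = 2 * (2 * k) + 2 \<and> 2 * k \<le> f'" ..
  qed
  fix j assume "j \<in> {1..2 * n + 2}"
  then show "A_wl j D = (if j = 4 * k + 1 then 2 else if j = 4 * k + 2 then 1 else 0)"
    by (simp only: A_wl_generated[OF assms(4,3)] f) (auto simp: two_length_pattern_def)
next
  assume n: "n = 3 * k + 1" and f: "freq 1 v + freq 3 v = 2 * k" "freq 2 v = k + 1"
  show "minimum_aberration (quaternary_designs n) D"
  proof (rule minimum_aberrationI[OF assms(4,3) f])
    show "4 * k + 2 = min (2 * (2 * k) + 2) (2 * k + 2 * (k + 1) + 1)" by simp
    fix f' t' assume bounds: "f' + t' \<le> n" "4 * k + 2 \<le> 2 * f' + 2" "4 * k + 2 \<le> f' + 2 * t' + 1"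
    \<comment> \<open>The second value forces \<open>t' = k\<close>. That competitor has its double
      unit at \<open>4 * k + 2\<close>, where \<open>D\<close> has a single one, so it loses
      there.\<close>
    then have "f' = 2 * k \<or> f' = 2 * k + 1" using n by linarith
    then show "f' = 2 * k \<and> t' = k + 1
        \<or> 2 * k + 1 < 2 * (k + 1) \<and> f' + 2 * t' + 1 = 2 * (2 * k) + 2 \<and> 2 * k \<le> f'"
      using bounds n by (elim disjE) simp_all
  qed
  fix j assume "j \<in> {1..2 * n + 2}"
  then show "A_wl j D = (if j = 4 * k + 2 then 1 else if j = 4 * k + 3 then 2 else 0)"
    by (simp only: A_wl_generated[OF assms(4,3)] f) (auto simp: two_length_pattern_def)
qed

end
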